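(* Let $\chi:\mathbb{R}\to\mathbb{R}$ be a kernel, let $r\ge 1$ be an integer and let $f\in C^{(r)}(\mathbb{R})$. Then there exist measurable functions $\theta_{k,w}:[k/w,(k+1)/w]\to\mathbb{R}$, $k\in\mathbb{Z}$, $w>0$, with $k/w<\theta_{k,w}(u)<(k+1)/w$ for every $u\in[k/w,(k+1)/w]$, such that for every $w>0$ and every $x\in\mathbb{R}$ $$(S_w f)(x)=\sum_{j=0}^{r-1}\frac{w^{-j}}{(j+1)!}\,\bigl(G_w f^{(j)}\bigr)(x)+\mathcal{R}^w_r(x),$$ where the remainder $$\mathcal{R}^w_r(x):=\frac{1}{r!}\sum_{k\in\mathbb{Z}}w\left[\int_{k/w}^{(k+1)/w}f^{(r)}\bigl(\theta_{k,w}(u)\bigr)\,(u-k/w)^r\,du\right]\chi(wx-k)$$ is an absolutely convergent series.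
   Context: $C(\mathbb{R})$ denotes the space of all uniformly continuous and bounded functions $f:\mathbb{R}\to\mathbb{R}$. For a positive integer $r$, $C^{(r)}(\mathbb{R})$ is the subspace of those $f\in C(\mathbb{R})$ whose derivatives $f^{(s)}$ exist and belong to $C(\mathbb{R})$ for every $1\le s\le r$; $f^{(0)}=f$. A kernel is a function $\chi:\mathbb{R}\to\mathbb{R}$ such that: (1) $\chi\in L^1(\mathbb{R})$ and $\chi$ is bounded in a neighbourhood of the origin; (2) $\sum_{k\in\mathbb{Z}}\chi(u-k)=1$ for every $u\in\mathbb{R}$; (3) there exists $\beta>0$ for which $M_\beta(\chi):=\sup_{u\in\mathbb{R}}\sum_{k\in\mathbb{Z}}|\chi(u-k)|\,|u-k|^\beta<+\infty$. For $w>0$ and $x\in\mathbb{R}$, the sampling Kantorovich operator and the generalized sampling operator based on $\chi$ are $$(S_w f)(x):=\sum_{k\in\mathbb{Z}}\chi(wx-k)\left[w\int_{k/w}^{(k+1)/w}f(u)\,du\right],\qquad (G_w f)(x):=\sum_{k\in\mathbb{Z}}\chi(wx-k)\,f\!\left(\frac{k}{w}\right).$$ *)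

theory Defs
  imports "HOL-Analysis.Analysis"
begin

text \<open>The spaces $C(\mathbb{R})$ and $C^{(r)}(\mathbb{R})$.  The term \<open>(deriv ^^ s) f\<close> is the
  $s$-th derivative; since \<open>deriv\<close> is a total operator, existence of the derivatives is
  required separately.\<close>

definition ucb :: "(real \<Rightarrow> real) set"
  where "ucb = {f. uniformly_continuous_on UNIV f \<and> bounded (range f)}"

definition ucb_diff :: "nat \<Rightarrow> (real \<Rightarrow> real) set"
  where "ucb_diff r =
    {f \<in> ucb. \<forall>s\<in>{1..r}. (\<forall>x. (deriv ^^ (s - 1)) f differentiable (at x)) \<and> (deriv ^^ s) f \<in> ucb}"

text \<open>The moment takes values in \<open>ennreal\<close>, so the sum and the supremum always
  exist and finiteness is an actual condition.\<close>

definition abs_moment :: "real \<Rightarrow> (real \<Rightarrow> real) \<Rightarrow> ennreal"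
  where "abs_moment \<beta> \<phi> =
    (SUP u. \<Sum>\<^sub>\<infinity>k::int. ennreal (\<bar>\<phi> (u - of_int k)\<bar> * \<bar>u - of_int k\<bar> powr \<beta>))"

definition sampling_kernel :: "(real \<Rightarrow> real) \<Rightarrow> bool"
  where "sampling_kernel \<phi> \<longleftrightarrow>
    integrable lebesgue \<phi> \<and>
    (\<exists>U. open U \<and> 0 \<in> U \<and> bounded (\<phi> ` U)) \<and>
    (\<forall>u. ((\<lambda>k::int. \<phi> (u - of_int k)) has_sum 1) UNIV) \<and>
    (\<exists>\<beta>>0. abs_moment \<beta> \<phi> < \<infinity>)"

definition cell :: "real \<Rightarrow> int \<Rightarrow> real set"
  where "cell w k = {of_int k / w .. (of_int k + 1) / w}"

definition kantorovich_op ::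
    "(real \<Rightarrow> real) \<Rightarrow> real \<Rightarrow> (real \<Rightarrow> real) \<Rightarrow> real \<Rightarrow> real"
  where "kantorovich_op \<phi> w f x =
    (\<Sum>\<^sub>\<infinity>k::int. \<phi> (w * x - of_int k) * (w * (LINT u|lebesgue_on (cell w k). f u)))"

definition sampling_op ::
    "(real \<Rightarrow> real) \<Rightarrow> real \<Rightarrow> (real \<Rightarrow> real) \<Rightarrow> real \<Rightarrow> real"
  where "sampling_op \<phi> w f x =
    (\<Sum>\<^sub>\<infinity>k::int. \<phi> (w * x - of_int k) * f (of_int k / w))"

text \<open>Only the values of \<open>\<theta> k w\<close> on \<open>cell w k\<close> matter below.\<close>

definition remainder_term ::
    "(real \<Rightarrow> real) \<Rightarrow> (real \<Rightarrow> real) \<Rightarrow> nat \<Rightarrow> (int \<Rightarrow> real \<Rightarrow> real \<Rightarrow> real) \<Rightarrow>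
     real \<Rightarrow> real \<Rightarrow> int \<Rightarrow> real"
  where "remainder_term \<phi> f r \<theta> w x k =
    w * (LINT u|lebesgue_on (cell w k). (deriv ^^ r) f (\<theta> k w u) * (u - of_int k / w) ^ r)
      * \<phi> (w * x - of_int k)"

definition remainder ::
    "(real \<Rightarrow> real) \<Rightarrow> (real \<Rightarrow> real) \<Rightarrow> nat \<Rightarrow> (int \<Rightarrow> real \<Rightarrow> real \<Rightarrow> real) \<Rightarrow>
     real \<Rightarrow> real \<Rightarrow> real"
  where "remainder \<phi> f r \<theta> w x = 1 / fact r * (\<Sum>\<^sub>\<infinity>k. remainder_term \<phi> f r \<theta> w x k)"

end

(* The intermediate point in the remainder may be taken independent of u: on a cell [a,b], Taylor's
   theorem for the antiderivative of f gives one \<xi> with f^(r)(\<xi>) (b-a)^(r+1) / (r+1)! as the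
   remainder of the integral of f, and that equals 1/r! times the integral of
   f^(r)(\<xi>) (u-a)^r.  The expansion is then summed over the cells; every series involved converges
   absolutely, since it is an absolutely summable series multiplied by a bounded sequence. *)

theory Submission imports Defs begin

lemma integral_taylor_up:
  fixes D :: "nat \<Rightarrow> real \<Rightarrow> real"
  assumes "a < b" and cont: "continuous_on UNIV (D 0)"
    and deriv: "\<And>j x. j < r \<Longrightarrow> (D j has_real_derivative D (Suc j) x) (at x)"
  shows "\<exists>\<xi>. a < \<xi> \<and> \<xi> < b \<and>
    integral {a..b} (D 0) =
      (\<Sum>j<r. D j a * (b - a) ^ (j + 1) / fact (j + 1)) + D r \<xi> * (b - a) ^ (r + 1) / fact (r + 1)"
proof -
  \<comment> \<open>Starting the antiderivative at \<open>a - 1\<close> makes it two-sidedly differentiable at \<open>a\<close> and \<open>b\<close>.\<close>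
  define F where "F x = integral {a - 1..x} (D 0)" for x
  have cont': "continuous_on S (D 0)" for S
    using cont continuous_on_subset by blast
  have F: "(F has_real_derivative D 0 x) (at x)" if "a \<le> x" "x \<le> b" for x
  proof -
    have "(F has_real_derivative D 0 x) (at x within {a - 1..b + 1})"
      unfolding F_def using that by (intro integral_has_real_derivative cont') auto
    moreover have "x \<in> interior {a - 1..b + 1}"
      using that by simp
    ultimately show ?thesis by (simp only: at_within_interior)
  qed
  have "(D 0 has_integral (F b - F a)) {a..b}"
    using \<open>a < b\<close> F
    by (intro fundamental_theorem_of_calculus)
       (auto simp: has_real_derivative_iff_has_vector_derivative[symmetric]
             intro: has_field_derivative_at_within)
  then have int: "integral {a..b} (D 0) = F b - F a"
    by (rule integral_unique)
  \<comment> \<open>Prepending the antiderivative shifts all derivatives by one place, so Taylor's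
    theorem of order r + 1 for \<open>F\<close> ends in \<open>D r\<close>. Its m = 0 term is
    \<open>F a\<close>, which moves to the left to form the integral; reindexing the others by m = j
    + 1 gives the factorials \<open>fact (j + 1)\<close>.\<close>
  define E where "E j = (case j of 0 \<Rightarrow> F | Suc i \<Rightarrow> D i)" for j
  have "\<exists>t>a. t < b \<and>
      F b = (\<Sum>m<Suc r. E m a / fact m * (b - a) ^ m) + E (Suc r) t / fact (Suc r) * (b - a) ^ Suc r"
    using \<open>a < b\<close> F deriv
    by (intro Taylor_up[where a = a]) (auto simp: E_def split: nat.splits)
  then obtain t where t: "a < t" "t < b"
    and "F b = (\<Sum>m<Suc r. E m a / fact m * (b - a) ^ m) + E (Suc r) t / fact (Suc r) * (b - a) ^ Suc r"
    by blast
  then have "F b - F a = (\<Sum>j<r. D j a * (b - a) ^ (j + 1) / fact (j + 1))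
      + D r t * (b - a) ^ (r + 1) / fact (r + 1)"
    unfolding sum.lessThan_Suc_shift by (simp add: E_def)
  with int t show ?thesis by auto
qed

text \<open>Links the Lebesgue integral of the definitions to the gauge integral, for which the
  fundamental theorem of calculus is available; a continuous function on a compact cell is
  integrable in both senses.\<close>

lemma LINT_cell_eq_integral:
  fixes g :: "real \<Rightarrow> 'b :: euclidean_space"
  assumes "continuous_on (cell w k) g"
  shows "(LINT u|lebesgue_on (cell w k). g u) = integral (cell w k) g"
  using assms unfolding cell_def
  by (intro lebesgue_integral_eq_integral continuous_imp_integrable_real) auto

text \<open>Evaluates the remainder integral once the factor f^(r)(\<xi>) no longer depends on
  u.\<close>

lemma LINT_cell_power:
  assumes "w > 0"
  shows "(LINT u|lebesgue_on (cell w k). c * (u - of_int k / w) ^ r) = c * (1 / w) ^ (r + 1) / (r + 1)"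
proof -
  let ?a = "of_int k / w" and ?b = "(of_int k + 1) / w"
  let ?G = "\<lambda>u. c * (u - ?a) ^ (r + 1) / (r + 1)"
  have ba: "?b - ?a = 1 / w"
    by (simp add: diff_divide_distrib[symmetric])
  have int: "((\<lambda>u. c * (u - ?a) ^ r) has_integral (?G ?b - ?G ?a)) {?a..?b}"
  proof (rule fundamental_theorem_of_calculus)
    show "?a \<le> ?b" using assms by (simp add: divide_right_mono)
    fix x
    have "(?G has_real_derivative c * (x - ?a) ^ r) (at x)"
      by (rule derivative_eq_intros refl | simp)+
    then show "(?G has_vector_derivative c * (x - ?a) ^ r) (at x within {?a..?b})"
      by (simp add: has_real_derivative_iff_has_vector_derivative has_vector_derivative_at_within)
  qed
  have "integral (cell w k) (\<lambda>u. c * (u - ?a) ^ r) = c * (1 / w) ^ (r + 1) / (r + 1)"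
    unfolding cell_def integral_unique[OF int] ba by simp
  moreover have "continuous_on (cell w k) (\<lambda>u. c * (u - ?a) ^ r)"
    by (intro continuous_intros)
  ultimately show ?thesis
    by (simp only: LINT_cell_eq_integral)
qed

text \<open>Unordered summability of reals is already absolute, so |g| * B is a summable
  majorant.\<close>

lemma summable_on_mult_bounded:
  fixes g c :: "'a \<Rightarrow> real"
  assumes "g summable_on A" and c: "\<And>k. k \<in> A \<Longrightarrow> \<bar>c k\<bar> \<le> B"
  shows "(\<lambda>k. \<bar>g k * c k\<bar>) summable_on A"
proof (rule summable_on_comparison_test)
  have "(\<lambda>k. norm (g k)) summable_on A"
    using assms(1) by (rule summable_on_iff_abs_summable_on_real[THEN iffD1])
  then show "(\<lambda>k. norm (g k) * B) summable_on A"
    by (rule summable_on_cmult_left)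
  show "\<bar>g k * c k\<bar> \<le> norm (g k) * B" if "k \<in> A" for k
    using c[OF that] by (simp add: abs_mult mult_left_mono)
qed simp

lemma has_sum_sum:
  fixes f :: "'i \<Rightarrow> 'a \<Rightarrow> 'b :: topological_comm_monoid_add"
  assumes "\<And>i. i \<in> I \<Longrightarrow> (f i has_sum S i) A"
  shows "((\<lambda>k. \<Sum>i\<in>I. f i k) has_sum (\<Sum>i\<in>I. S i)) A"
  using assms by (induction I rule: infinite_finite_induct) (auto intro: has_sum_add)

lemma ucb_diff_has_derivative:
  assumes "f \<in> ucb_diff r" "j < r"
  shows "((deriv ^^ j) f has_real_derivative (deriv ^^ Suc j) f x) (at x)"
proof -
  have "Suc j \<in> {1..r}" using assms(2) by simp
  then have "(deriv ^^ j) f differentiable (at x)"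
    using assms(1) unfolding ucb_diff_def by fastforce
  then show ?thesis
    by (simp add: DERIV_deriv_iff_real_differentiable)
qed

lemma ucb_diff_deriv_ucb:
  assumes "f \<in> ucb_diff r" "j \<le> r"
  shows "(deriv ^^ j) f \<in> ucb"
  using assms by (cases "j = 0") (auto simp: ucb_diff_def)

lemma ucb_bounded:
  assumes "g \<in> ucb"
  obtains B where "\<And>x. \<bar>g x\<bar> \<le> B"
  using assms unfolding ucb_def by (auto simp: bounded_iff)

theorem theorem3p1:
  fixes \<phi> f :: "real \<Rightarrow> real" and r :: nat
  assumes "sampling_kernel \<phi>" and "r \<ge> 1" and "f \<in> ucb_diff r"
  shows "\<exists>\<theta> :: int \<Rightarrow> real \<Rightarrow> real \<Rightarrow> real.
    (\<forall>k w. w > 0 \<longrightarrow>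
       \<theta> k w \<in> borel_measurable (lebesgue_on (cell w k)) \<and>
       (\<forall>u\<in>cell w k. of_int k / w < \<theta> k w u \<and> \<theta> k w u < (of_int k + 1) / w)) \<and>
    (\<forall>w x. w > 0 \<longrightarrow>
       (\<lambda>k. \<bar>remainder_term \<phi> f r \<theta> w x k\<bar>) summable_on UNIV \<and>
       kantorovich_op \<phi> w f x =
         (\<Sum>j<r. w powi (- int j) / fact (j + 1) * sampling_op \<phi> w ((deriv ^^ j) f) x)
         + remainder \<phi> f r \<theta> w x)"
proof -
  let ?D = "\<lambda>j. (deriv ^^ j) f"
  have cont: "continuous_on S f" for S
    using assms(3) uniformly_continuous_imp_continuous continuous_on_subset
    unfolding ucb_diff_def ucb_def by blast
  \<comment> \<open>The condition does not mention x, so one choice of \<xi> per cell serves every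
    x. The factor w cancels one power of 1 / w in the Taylor terms, which leaves
    \<open>w powi (- int j)\<close>.\<close>
  define taylor_point where "taylor_point k w \<xi> \<longleftrightarrow>
      of_int k / w < \<xi> \<and> \<xi> < (of_int k + 1) / w \<and>
      w * (LINT u|lebesgue_on (cell w k). f u) =
        (\<Sum>j<r. w powi (- int j) / fact (j + 1) * ?D j (of_int k / w)) +
        ?D r \<xi> * (1 / w) ^ r / fact (r + 1)" for k :: int and w \<xi> :: real
  have "\<exists>\<xi>. taylor_point k w \<xi>" if "w > 0" for k w
  proof -
    let ?a = "of_int k / w" and ?b = "(of_int k + 1) / w"
    have ba: "?b - ?a = 1 / w"
      by (simp add: diff_divide_distrib[symmetric])
    have "?a < ?b" using that by (simp add: divide_strict_right_mono)
    then obtain \<xi> where \<xi>: "?a < \<xi>" "\<xi> < ?b" "integral {?a..?b} f =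
        (\<Sum>j<r. ?D j ?a * (1 / w) ^ (j + 1) / fact (j + 1)) + ?D r \<xi> * (1 / w) ^ (r + 1) / fact (r + 1)"
      using integral_taylor_up[of ?a ?b ?D r] ucb_diff_has_derivative[OF assms(3)] cont
      unfolding ba by auto
    have "w * (LINT u|lebesgue_on (cell w k). f u) =
        (\<Sum>j<r. w * (?D j ?a * (1 / w) ^ (j + 1) / fact (j + 1))) +
        w * (?D r \<xi> * (1 / w) ^ (r + 1) / fact (r + 1))"
      unfolding LINT_cell_eq_integral[OF cont] unfolding cell_def \<xi>(3)
      by (simp only: sum_distrib_left distrib_left)
    moreover have "w * (?D j ?a * (1 / w) ^ (j + 1) / fact (j + 1)) =
        w powi (- int j) / fact (j + 1) * ?D j ?a" for j
      using that by (simp add: power_int_minus power_one_over inverse_eq_divide)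
    moreover have "w * (?D r \<xi> * (1 / w) ^ (r + 1) / fact (r + 1)) =
        ?D r \<xi> * (1 / w) ^ r / fact (r + 1)"
      using that by simp
    ultimately show ?thesis using \<xi>(1,2) unfolding taylor_point_def by auto
  qed
  moreover define \<xi> where "\<xi> k w = (SOME z. taylor_point k w z)" for k w
  ultimately have "taylor_point k w (\<xi> k w)" if "w > 0" for k w
    using that by (auto intro: someI_ex)
  then have \<xi>: "\<And>k w. w > 0 \<Longrightarrow> of_int k / w < \<xi> k w \<and> \<xi> k w < (of_int k + 1) / w"
    and expand: "\<And>k w. w > 0 \<Longrightarrow> w * (LINT u|lebesgue_on (cell w k). f u) =
        (\<Sum>j<r. w powi (- int j) / fact (j + 1) * ?D j (of_int k / w)) +
        ?D r (\<xi> k w) * (1 / w) ^ r / fact (r + 1)"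
    unfolding taylor_point_def by blast+
  \<comment> \<open>Being constant in u, \<theta> is trivially measurable, and its strict bounds
    hold at the endpoints of the cell as well.\<close>
  define \<theta> where "\<theta> = (\<lambda>k w (u :: real). \<xi> k w)"
  \<comment> \<open>The partition of unity, stated as \<open>has_sum\<close>, carries the
    convergence of all the series below.\<close>
  have kernel: "(\<lambda>k::int. \<phi> (u - of_int k)) summable_on UNIV" for u
    using assms(1) has_sum_imp_summable unfolding sampling_kernel_def by blast
  have rem: "remainder_term \<phi> f r \<theta> w x k =
      \<phi> (w * x - of_int k) * (?D r (\<xi> k w) * ((1 / w) ^ r / (r + 1)))" if "w > 0" for w x k
    using that LINT_cell_power[OF that, of k "?D r (\<xi> k w)" r]
    unfolding remainder_term_def \<theta>_def by simp
  \<comment> \<open>Used twice: with t k = k / w and c = 1 for the sampling series (j < r), and with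
    t k = \<xi> k w and c = (1 / w)^r / (r + 1) for the remainder (j = r).\<close>
  have summable: "(\<lambda>k::int. \<bar>\<phi> (u - of_int k) * (?D j (t k) * c)\<bar>) summable_on UNIV"
    if "j \<le> r" for j u t c
  proof -
    obtain B where "\<And>x. \<bar>?D j x\<bar> \<le> B"
      using ucb_bounded[OF ucb_diff_deriv_ucb[OF assms(3) \<open>j \<le> r\<close>]] by blast
    then have "\<bar>?D j (t k) * c\<bar> \<le> B * \<bar>c\<bar>" for k
      by (simp add: abs_mult mult_right_mono)
    then show ?thesis by (intro summable_on_mult_bounded[OF kernel])
  qed
  have rem_summable: "(\<lambda>k. \<bar>remainder_term \<phi> f r \<theta> w x k\<bar>) summable_on UNIV" if "w > 0" for w x
    using summable[OF order_refl] unfolding rem[OF that] .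
  have "kantorovich_op \<phi> w f x =
      (\<Sum>j<r. w powi (- int j) / fact (j + 1) * sampling_op \<phi> w (?D j) x) + remainder \<phi> f r \<theta> w x"
    if "w > 0" for w x
  proof -
    have sampling: "((\<lambda>k. \<phi> (w * x - of_int k) * ?D j (of_int k / w)) has_sum
        sampling_op \<phi> w (?D j) x) UNIV" if "j < r" for j
      using summable[OF less_imp_le[OF that], of "w * x" "\<lambda>k. of_int k / w" 1]
      unfolding sampling_op_def by (intro has_sum_infsum) (simp add: abs_summable_summable)
    have remainder: "((\<lambda>k. 1 / fact r * remainder_term \<phi> f r \<theta> w x k) has_sum
        remainder \<phi> f r \<theta> w x) UNIV"
      using rem_summable[OF that, of x] unfolding remainder_def
      by (intro has_sum_cmult_right has_sum_infsum) (simp add: abs_summable_summable)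
    \<comment> \<open>The cell expansion times the kernel value. The 1 / (r + 1) from the integral
      of the power and the prefactor \<open>1 / fact r\<close> combine to
      \<open>1 / fact (r + 1)\<close>.\<close>
    have "\<phi> (w * x - of_int k) * (w * (LINT u|lebesgue_on (cell w k). f u)) =
        (\<Sum>j<r. w powi (- int j) / fact (j + 1) * (\<phi> (w * x - of_int k) * ?D j (of_int k / w)))
        + 1 / fact r * remainder_term \<phi> f r \<theta> w x k" for k
      unfolding expand[OF that] rem[OF that] distrib_left sum_distrib_left
      by (intro arg_cong2[of _ _ _ _ "(+)"] sum.cong) (simp_all add: algebra_simps)
    \<comment> \<open>Only finitely many convergent series are added, so no interchange of limits
      arises. The resulting \<open>has_sum\<close> also shows that the Kantorovich series converges,
      so that its \<open>infsum\<close> is a genuine sum and not a default value.\<close>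
    moreover have "((\<lambda>k. (\<Sum>j<r. w powi (- int j) / fact (j + 1) *
          (\<phi> (w * x - of_int k) * ?D j (of_int k / w))) + 1 / fact r * remainder_term \<phi> f r \<theta> w x k)
        has_sum (\<Sum>j<r. w powi (- int j) / fact (j + 1) * sampling_op \<phi> w (?D j) x)
          + remainder \<phi> f r \<theta> w x) UNIV"
      using sampling by (intro has_sum_add has_sum_sum has_sum_cmult_right remainder) auto
    ultimately show ?thesis
      unfolding kantorovich_op_def by (simp add: infsumI)
  qed
  with \<xi> rem_summable show ?thesis
    by (intro exI[of _ \<theta>]) (auto simp: \<theta>_def)
qed

end
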